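(* Let $n$ be an integer, $\theta_n$ a closed $\lambda C$-term with $\vdash_{M2}\theta_n:N^C[s^n(0)]$, and $x,g$ two distinct variables. (i) If $n=0$, then for every stack constant $p$: $(\theta_n)x\,g\,p\triangleright_C(x)p$. (ii) If $n\neq0$, then there exist $m\geq1$, indices $r_0,\dots,r_m\in\{0,\dots,m\}$ and a mapping $I:\{0,\dots,m\}\to\mathbb{N}$ such that for all distinct stack constants $p_0,\dots,p_m$ there are terms $t_1,\dots,t_m$ with $(\theta_n)x\,g\,p_0\triangleright_C(g)t_1p_{r_0}$; $(t_i)p_i\triangleright_C(g)t_{i+1}p_{r_i}$ for $1\leq i\leq m-1$; $(t_m)p_m\triangleright_C(x)p_{r_m}$; where $I(0)=n$, $I(r_m)=0$, and $I(i+1)=I(r_i)-1$ for $0\leq i\leq m-1$.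
   Context: $\lambda C$-terms are terms of the pure $\lambda$-calculus extended with a constant $C$; $(t)u_1\dots u_n$ is iterated application. $P$ is an infinite set of stack constants. $\Lambda CP$ is the least set of terms containing all variables, closed under $\lambda$-abstraction, and such that if $t\in\Lambda CP$ and $u\in\Lambda CP\cup P$ then $(t)u\in\Lambda CP$. On $\Lambda CP$, $\triangleright_C$ is the reflexive–transitive closure of $(\lambda xu)t\,t_1\dots t_n\to(u[t/x])t_1\dots t_n$ ($u,t\in\Lambda CP$, $t_i\in\Lambda CP\cup P$) and $(C)t\,t_1\dots t_n\to(t)\lambda x(x)t_1\dots t_n$ ($t\in\Lambda CP$, $t_i\in\Lambda CP\cup P$, $x$ fresh). Types: second-order formulas over a language with constant $0$ and unary function $s$, built from $\perp$ and atomic formulas using $\rightarrow,\forall x,\forall X$; $\neg A=A\rightarrow\perp$; equations $u=v:=\forall Y(Y(u)\rightarrow Y(v))$; a fixed set of equations $E$ ($a\approx b$ iff $E$ entails $a=b$), adequate: $s(a)\not\approx0$ and $s(a)\approx s(b)\Rightarrow a\approx b$. $M2$: besides ordinary predicate variables there are classical predicate variables $X_C$; a type ends with $X$ if it is $X(\vec t)$, or $A\rightarrow B$ with $B$ ending with $X$, or $\forall vA$ with $A$ ending with $X$; a classical type ends with $\perp$ or a classical variable. Rules: axiom; $\rightarrow$-intro/elim; $\forall x$-intro/elim; $\forall X$-intro/elim (any formula) for ordinary $X$; equational rule; $\Gamma\vdash C:\forall X_C\{\neg\neg X_C\rightarrow X_C\}$; $\forall X_C$-intro ($X_C$ not free in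 context); $\forall X_C$-elim only with classical types. $N^C[x]=\forall X_C\{X_C(0),\forall y(X_C(y)\rightarrow X_C(sy))\rightarrow X_C(x)\}$. *)

theory Defs
  imports Main
begin

section \<open>\<lambda>C-terms with stack constants\<close>

text \<open>
  De Bruijn indices; a dangling index denotes a free variable, so distinct free variables are
  distinct indices.  The stack constants are the elements of the type \<open>'p\<close>.  The datatype
  allows them in any position; the sets \<open>LC\<close> and \<open>LCP\<close> below carve out the actual terms.
\<close>

datatype 'p trm = Var nat | Cc | Stk 'p | Lam "'p trm" | App "'p trm" "'p trm"

primrec fv :: "'p trm \<Rightarrow> nat set" where
  "fv (Var i) = {i}"
| "fv Cc = {}"
| "fv (Stk p) = {}"
| "fv (Lam t) = {i. Suc i \<in> fv t}"
| "fv (App t u) = fv t \<union> fv u"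

definition closed_trm :: "'p trm \<Rightarrow> bool" where
  "closed_trm t \<longleftrightarrow> fv t = {}"

primrec lift :: "'p trm \<Rightarrow> nat \<Rightarrow> 'p trm" where
  "lift (Var i) k = (if i < k then Var i else Var (Suc i))"
| "lift Cc k = Cc"
| "lift (Stk p) k = Stk p"
| "lift (Lam t) k = Lam (lift t (Suc k))"
| "lift (App t u) k = App (lift t k) (lift u k)"

primrec subst :: "'p trm \<Rightarrow> 'p trm \<Rightarrow> nat \<Rightarrow> 'p trm" where
  "subst (Var i) s k = (if k < i then Var (i - 1) else if i = k then s else Var i)"
| "subst Cc s k = Cc"
| "subst (Stk p) s k = Stk p"
| "subst (Lam t) s k = Lam (subst t (lift s 0) (Suc k))"
| "subst (App t u) s k = App (subst t s k) (subst u s k)"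

inductive_set LC :: "'p trm set" where
  "Var i \<in> LC"
| "Cc \<in> LC"
| "t \<in> LC \<Longrightarrow> Lam t \<in> LC"
| "t \<in> LC \<Longrightarrow> u \<in> LC \<Longrightarrow> App t u \<in> LC"

text \<open>The set \<open>\<Lambda>CP\<close>: stack constants occur in argument position only.\<close>

inductive_set LCP :: "'p trm set" where
  "Var i \<in> LCP"
| "Cc \<in> LCP"
| "t \<in> LCP \<Longrightarrow> Lam t \<in> LCP"
| "t \<in> LCP \<Longrightarrow> u \<in> LCP \<or> u \<in> range Stk \<Longrightarrow> App t u \<in> LCP"

abbreviation apps :: "'p trm \<Rightarrow> 'p trm list \<Rightarrow> 'p trm" where
  "apps t us \<equiv> foldl App t us"

text \<open>
  The rule for \<open>Cc\<close> captures the whole list of remaining arguments, so a step is a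
  step of the entire term and is not closed under any context.
\<close>

inductive cstep :: "'p trm \<Rightarrow> 'p trm \<Rightarrow> bool" where
  beta: "u \<in> LCP \<Longrightarrow> t \<in> LCP \<Longrightarrow> set ts \<subseteq> LCP \<union> range Stk \<Longrightarrow>
    cstep (apps (App (Lam u) t) ts) (apps (subst u t 0) ts)"
| control: "t \<in> LCP \<Longrightarrow> set ts \<subseteq> LCP \<union> range Stk \<Longrightarrow>
    cstep (apps (App Cc t) ts) (App t (Lam (apps (Var 0) (map (\<lambda>u. lift u 0) ts))))"

abbreviation reduces :: "'p trm \<Rightarrow> 'p trm \<Rightarrow> bool"  (infix "\<triangleright>" 50) where
  "t \<triangleright> u \<equiv> cstep\<^sup>*\<^sup>* t u"


section \<open>Individual terms and equations\<close>

text \<open>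
  A language consists of \<open>0\<close>, \<open>s\<close> and arbitrary further function and relation symbols,
  each given by a name together with its arity.
\<close>

record ('f, 'r) language =
  funs :: "('f \<times> nat) set"
  rels :: "('r \<times> nat) set"

datatype 'f iterm = IVar nat | Zero | Succ "'f iterm" | Fn 'f "'f iterm list"

fun wf_iterm :: "('f, 'r) language \<Rightarrow> 'f iterm \<Rightarrow> bool" where
  "wf_iterm L (IVar i) \<longleftrightarrow> True"
| "wf_iterm L Zero \<longleftrightarrow> True"
| "wf_iterm L (Succ a) \<longleftrightarrow> wf_iterm L a"
| "wf_iterm L (Fn f as) \<longleftrightarrow> (f, length as) \<in> funs L \<and> list_all (wf_iterm L) as"

primrec tsubst :: "(nat \<Rightarrow> 'f iterm) \<Rightarrow> 'f iterm \<Rightarrow> 'f iterm" where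
  "tsubst \<sigma> (IVar i) = \<sigma> i"
| "tsubst \<sigma> Zero = Zero"
| "tsubst \<sigma> (Succ a) = Succ (tsubst \<sigma> a)"
| "tsubst \<sigma> (Fn f as) = Fn f (map (tsubst \<sigma>) as)"

text \<open>
  \<open>a \<approx> b\<close>: the equation \<open>a = b\<close> follows from \<open>E\<close>, the equations of \<open>E\<close> being read as
  universally closed.  An equation is represented by the pair of its sides; as \<open>a = b\<close>
  is Leibniz equality, entailment is derivability in equational logic.
\<close>

inductive eqv :: "('f, 'r) language \<Rightarrow> ('f iterm \<times> 'f iterm) set \<Rightarrow> 'f iterm \<Rightarrow> 'f iterm \<Rightarrow> bool"
  for L E where
  inst: "(a, b) \<in> E \<Longrightarrow> (\<And>i. wf_iterm L (\<sigma> i)) \<Longrightarrow> eqv L E (tsubst \<sigma> a) (tsubst \<sigma> b)"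
| refl: "wf_iterm L a \<Longrightarrow> eqv L E a a"
| sym: "eqv L E a b \<Longrightarrow> eqv L E b a"
| trans: "eqv L E a b \<Longrightarrow> eqv L E b c \<Longrightarrow> eqv L E a c"
| cong_Succ: "eqv L E a b \<Longrightarrow> eqv L E (Succ a) (Succ b)"
| cong_Fn: "(f, length as) \<in> funs L \<Longrightarrow> list_all2 (eqv L E) as bs \<Longrightarrow> eqv L E (Fn f as) (Fn f bs)"

definition wf_equations :: "('f, 'r) language \<Rightarrow> ('f iterm \<times> 'f iterm) set \<Rightarrow> bool" where
  "wf_equations L E \<longleftrightarrow> (\<forall>(a, b) \<in> E. wf_iterm L a \<and> wf_iterm L b)"

definition adequate :: "('f, 'r) language \<Rightarrow> ('f iterm \<times> 'f iterm) set \<Rightarrow> bool" where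
  "adequate L E \<longleftrightarrow>
     (\<forall>a. wf_iterm L a \<longrightarrow> \<not> eqv L E (Succ a) Zero) \<and>
     (\<forall>a b. wf_iterm L a \<longrightarrow> wf_iterm L b \<longrightarrow> eqv L E (Succ a) (Succ b) \<longrightarrow> eqv L E a b)"


section \<open>Types\<close>

text \<open>
  De Bruijn indices again.  Individual variables have one index space; predicate variables have
  a separate index space for each sort and arity: \<open>PVar c i as\<close> is the \<open>i\<close>-th variable of sort
  \<open>c\<close> and arity \<open>length as\<close> applied to \<open>as\<close>, and \<open>All2 c n A\<close> binds index \<open>0\<close> of the space
  of \<open>n\<close>-ary variables of sort \<open>c\<close>.
\<close>

datatype sort = Ordinary | Classical

datatype ('f, 'r) form =
    Bot
  | PVar sort nat "'f iterm list"
  | Rel 'r "'f iterm list"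
  | Imp "('f, 'r) form" "('f, 'r) form"
  | All1 "('f, 'r) form"
  | All2 sort nat "('f, 'r) form"

abbreviation Neg :: "('f, 'r) form \<Rightarrow> ('f, 'r) form" where
  "Neg A \<equiv> Imp A Bot"

primrec wf_form :: "('f, 'r) language \<Rightarrow> ('f, 'r) form \<Rightarrow> bool" where
  "wf_form L Bot \<longleftrightarrow> True"
| "wf_form L (PVar c i as) \<longleftrightarrow> list_all (wf_iterm L) as"
| "wf_form L (Rel R as) \<longleftrightarrow> (R, length as) \<in> rels L \<and> list_all (wf_iterm L) as"
| "wf_form L (Imp A B) \<longleftrightarrow> wf_form L A \<and> wf_form L B"
| "wf_form L (All1 A) \<longleftrightarrow> wf_form L A"
| "wf_form L (All2 c n A) \<longleftrightarrow> wf_form L A"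

definition up :: "(nat \<Rightarrow> 'f iterm) \<Rightarrow> nat \<Rightarrow> 'f iterm" where
  "up \<sigma> i = (case i of 0 \<Rightarrow> IVar 0 | Suc j \<Rightarrow> tsubst (\<lambda>k. IVar (Suc k)) (\<sigma> j))"

primrec isubst :: "(nat \<Rightarrow> 'f iterm) \<Rightarrow> ('f, 'r) form \<Rightarrow> ('f, 'r) form" where
  "isubst \<sigma> Bot = Bot"
| "isubst \<sigma> (PVar c i as) = PVar c i (map (tsubst \<sigma>) as)"
| "isubst \<sigma> (Rel R as) = Rel R (map (tsubst \<sigma>) as)"
| "isubst \<sigma> (Imp A B) = Imp (isubst \<sigma> A) (isubst \<sigma> B)"
| "isubst \<sigma> (All1 A) = All1 (isubst (up \<sigma>) A)"
| "isubst \<sigma> (All2 c n A) = All2 c n (isubst \<sigma> A)"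

text \<open>
  \<open>inst as\<close> replaces the first \<open>length as\<close> variables by \<open>as\<close> and removes them from the index space;
  \<open>shift n\<close> makes room for one new variable, keeping the indices below \<open>n\<close>.
\<close>

definition inst :: "'f iterm list \<Rightarrow> nat \<Rightarrow> 'f iterm" where
  "inst as i = (if i < length as then as ! i else IVar (i - length as))"

definition shift :: "nat \<Rightarrow> nat \<Rightarrow> 'f iterm" where
  "shift n i = (if i < n then IVar i else IVar (Suc i))"

text \<open>\<open>plift A c n k\<close> makes room for an \<open>n\<close>-ary predicate variable of sort \<open>c\<close> with index \<open>k\<close>.\<close>

primrec plift :: "('f, 'r) form \<Rightarrow> sort \<Rightarrow> nat \<Rightarrow> nat \<Rightarrow> ('f, 'r) form" where
  "plift Bot c n k = Bot"
| "plift (PVar d i as) c n k =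
     (if d = c \<and> length as = n \<and> k \<le> i then PVar d (Suc i) as else PVar d i as)"
| "plift (Rel R as) c n k = Rel R as"
| "plift (Imp A B) c n k = Imp (plift A c n k) (plift B c n k)"
| "plift (All1 A) c n k = All1 (plift A c n k)"
| "plift (All2 d m A) c n k =
     All2 d m (plift A c n (if d = c \<and> m = n then Suc k else k))"

text \<open>
  \<open>psubst A c n k G\<close> is \<open>A[G/X(x\<^sub>1,\<dots>,x\<^sub>n)]\<close> where \<open>X\<close> is the \<open>n\<close>-ary predicate variable of sort
  \<open>c\<close> with index \<open>k\<close>.  The parameters \<open>x\<^sub>1,\<dots>,x\<^sub>n\<close> are the individual variables \<open>0,\<dots>,n-1\<close> of
  \<open>G\<close>; its other individual variables are shifted by \<open>n\<close>.
\<close>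

primrec psubst ::
  "('f, 'r) form \<Rightarrow> sort \<Rightarrow> nat \<Rightarrow> nat \<Rightarrow> ('f, 'r) form \<Rightarrow> ('f, 'r) form" where
  "psubst Bot c n k G = Bot"
| "psubst (PVar d i as) c n k G =
     (if d = c \<and> length as = n
      then if i = k then isubst (inst as) G else if k < i then PVar d (i - 1) as else PVar d i as
      else PVar d i as)"
| "psubst (Rel R as) c n k G = Rel R as"
| "psubst (Imp A B) c n k G = Imp (psubst A c n k G) (psubst B c n k G)"
| "psubst (All1 A) c n k G = All1 (psubst A c n k (isubst (shift n) G))"
| "psubst (All2 d m A) c n k G =
     All2 d m (psubst A c n (if d = c \<and> m = n then Suc k else k) (plift G d m 0))"

text \<open>
  The atomic formula a type ends with.  The quantified variable in \<open>\<forall>v A\<close> is arbitrary; in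
  particular a type such as \<open>\<forall>X\<^sub>C X\<^sub>C\<close> ends with \<open>X\<^sub>C\<close> and is classical.
\<close>

primrec ending :: "('f, 'r) form \<Rightarrow> ('f, 'r) form" where
  "ending Bot = Bot"
| "ending (PVar c i as) = PVar c i as"
| "ending (Rel R as) = Rel R as"
| "ending (Imp A B) = ending B"
| "ending (All1 A) = ending A"
| "ending (All2 c n A) = ending A"

definition classical :: "('f, 'r) form \<Rightarrow> bool" where
  "classical A \<longleftrightarrow> ending A = Bot \<or> (\<exists>i as. ending A = PVar Classical i as)"


section \<open>The system \<open>M2\<close>\<close>

text \<open>
  The \<open>i\<close>-th entry of a context is the type of the variable with index \<open>i\<close>.  In the introduction
  rules for quantifiers, lifting the context expresses that the variable is not free in it.
\<close>

inductive M2 ::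
  "('f, 'r) language \<Rightarrow> ('f iterm \<times> 'f iterm) set \<Rightarrow> ('f, 'r) form list \<Rightarrow> 'p trm \<Rightarrow> ('f, 'r) form \<Rightarrow> bool"
  for L E where
  ax: "list_all (wf_form L) \<Gamma> \<Longrightarrow> i < length \<Gamma> \<Longrightarrow> M2 L E \<Gamma> (Var i) (\<Gamma> ! i)"
| imp_intro: "M2 L E (A # \<Gamma>) t B \<Longrightarrow> M2 L E \<Gamma> (Lam t) (Imp A B)"
| imp_elim: "M2 L E \<Gamma> t (Imp A B) \<Longrightarrow> M2 L E \<Gamma> u A \<Longrightarrow> M2 L E \<Gamma> (App t u) B"
| all1_intro: "M2 L E (map (isubst (shift 0)) \<Gamma>) t A \<Longrightarrow> M2 L E \<Gamma> t (All1 A)"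
| all1_elim: "M2 L E \<Gamma> t (All1 A) \<Longrightarrow> wf_iterm L a \<Longrightarrow> M2 L E \<Gamma> t (isubst (inst [a]) A)"
| all2_intro: "M2 L E (map (\<lambda>B. plift B Ordinary n 0) \<Gamma>) t A \<Longrightarrow> M2 L E \<Gamma> t (All2 Ordinary n A)"
| all2_elim: "M2 L E \<Gamma> t (All2 Ordinary n A) \<Longrightarrow> wf_form L G \<Longrightarrow>
    M2 L E \<Gamma> t (psubst A Ordinary n 0 G)"
| equation: "M2 L E \<Gamma> t (isubst (inst [a]) A) \<Longrightarrow> eqv L E a b \<Longrightarrow> M2 L E \<Gamma> t (isubst (inst [b]) A)"
| control: "list_all (wf_form L) \<Gamma> \<Longrightarrow>
    M2 L E \<Gamma> Cc (All2 Classical 0 (Imp (Neg (Neg (PVar Classical 0 []))) (PVar Classical 0 [])))"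
| allC_intro: "M2 L E (map (\<lambda>B. plift B Classical n 0) \<Gamma>) t A \<Longrightarrow> M2 L E \<Gamma> t (All2 Classical n A)"
| allC_elim: "M2 L E \<Gamma> t (All2 Classical n A) \<Longrightarrow> wf_form L G \<Longrightarrow> classical G \<Longrightarrow>
    M2 L E \<Gamma> t (psubst A Classical n 0 G)"

definition NC :: "'f iterm \<Rightarrow> ('f, 'r) form" where
  "NC a = All2 Classical 1
     (Imp (PVar Classical 0 [Zero])
     (Imp (All1 (Imp (PVar Classical 0 [IVar 0]) (PVar Classical 0 [Succ (IVar 0)])))
          (PVar Classical 0 [a])))"

end

theory Submission
  imports Defs "HOL-Library.Nat_Bijection"
begin

text \<open>
  Realizability in the style of Krivine.  For a set of terms closed under anti-reduction (the pole), a formula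
  denotes a set of stacks, and its realizers are the terms which every such stack brings into the
  pole; all predicate variables, ordinary or classical, range over arbitrary sets of stacks.
  Index the stack constants injectively as \<open>c (k, j)\<close> and let \<open>X(a)\<close> denote the
  one-element stacks \<open>c (k, j)\<close> with \<open>a \<approx> s\<^sup>k(0)\<close>.  The pole is the least set
  closed under anti-reduction which contains all \<open>(x) c (0, j)\<close>, and contains
  \<open>(g) t c (k + 1, j')\<close> as soon as it contains \<open>(t) c (k, j)\<close> for all \<open>j\<close>.  Then
  \<open>x\<close> realizes \<open>X(0)\<close>, \<open>g\<close> realizes \<open>\<forall>y (X(y) \<rightarrow> X(sy))\<close>, and so
  \<open>(\<theta>) x g c (n, 0)\<close> is in the pole.  Unfolding this membership, with a fresh \<open>j\<close> at
  every call of \<open>g\<close>, gives the required run, \<open>I\<close> being the first component of the index.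
  As reduction creates no stack constants, a constant on top of the stack is one of those supplied
  before, which gives the \<open>r\<^sub>i\<close>.  Renaming the constants transfers the run to any \<open>p\<^sub>i\<close>.
\<close>

section \<open>Terms and reduction\<close>

text \<open>Adequacy replaces all free variables of a typed term by realizers at once, which
  iterated \<open>subst\<close> would express only clumsily.\<close>

primrec psub :: "(nat \<Rightarrow> 'p trm) \<Rightarrow> 'p trm \<Rightarrow> 'p trm" where
  "psub \<tau> (Var i) = \<tau> i"
| "psub \<tau> Cc = Cc"
| "psub \<tau> (Stk p) = Stk p"
| "psub \<tau> (Lam t) = Lam (psub (case_nat (Var 0) (\<lambda>i. lift (\<tau> i) 0)) t)"
| "psub \<tau> (App t u) = App (psub \<tau> t) (psub \<tau> u)"

lemma psub_cong: "(\<And>i. \<tau> i = \<tau>' i) \<Longrightarrow> psub \<tau> t = psub \<tau>' t"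
  by presburger

lemma psub_Var: "psub Var t = t"
proof (induction t)
  case (Lam t)
  have "case_nat (Var 0) (\<lambda>i. lift (Var i) 0) = (Var :: nat \<Rightarrow> 'a trm)"
    by (auto split: nat.split)
  with Lam show ?case by simp
qed auto

lemma lift_lift: "j \<le> k \<Longrightarrow> lift (lift t k) j = lift (lift t j) (Suc k)"
  by (induction t arbitrary: j k) auto

lemma lift_subst: "k \<le> j \<Longrightarrow> lift (subst t s j) k = subst (lift t k) (lift s k) (Suc j)"
  by (induction t arbitrary: j k s) (auto simp: lift_lift)

lemma subst_lift: "subst (lift t k) u k = t"
  by (induction t arbitrary: k u) auto

lemma subst_psub: "subst (psub \<tau> t) s k = psub (\<lambda>i. subst (\<tau> i) s k) t"
proof (induction t arbitrary: \<tau> s k)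
  case (Lam t)
  show ?case
    by (auto simp: Lam lift_subst intro!: psub_cong split: nat.split)
qed auto

text \<open>Contracting a redex whose body is already instantiated amounts to extending the
  environment by the argument. This is the form needed for arrow introduction.\<close>

lemma subst_psub_0:
  "subst (psub (case_nat (Var 0) (\<lambda>i. lift (\<tau> i) 0)) t) u 0 = psub (case_nat u \<tau>) t"
  unfolding subst_psub by (auto simp: subst_lift intro!: psub_cong split: nat.split)

lemma lift_LCP: "t \<in> LCP \<Longrightarrow> lift t k \<in> LCP"
  by (induction t arbitrary: k rule: LCP.induct) (auto intro: LCP.intros)

lemma LCP_psub: "t \<in> LC \<Longrightarrow> (\<And>i. \<tau> i \<in> LCP) \<Longrightarrow> psub \<tau> t \<in> LCP"
proof (induction t arbitrary: \<tau> rule: LC.induct)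
  case (3 t)
  have "case_nat (Var 0) (\<lambda>i. lift (\<tau> i) 0) i \<in> LCP" for i
    using 3 by (auto intro: LCP.intros lift_LCP split: nat.split)
  then show ?case by (auto intro: LCP.intros 3)
qed (auto intro: LCP.intros)

lemma apps_LCP: "t \<in> LCP \<Longrightarrow> set ts \<subseteq> LCP \<union> range Stk \<Longrightarrow> apps t ts \<in> LCP"
proof (induction ts arbitrary: t)
  case (Cons u ts)
  then show ?case by (auto intro!: LCP.intros)
qed simp

section \<open>Stack constants occurring in a term\<close>

lemma set_trm_apps: "set_trm (apps t ts) = set_trm t \<union> (\<Union>u\<in>set ts. set_trm u)"
  by (induction ts arbitrary: t) auto

lemma set_trm_lift: "set_trm (lift t k) = set_trm t"
  by (induction t arbitrary: k) auto

lemma set_trm_subst: "set_trm (subst t s k) \<subseteq> set_trm t \<union> set_trm s"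
proof (induction t arbitrary: s k)
  case (Lam t)
  show ?case using Lam[of "lift s 0" "Suc k"] by (simp add: set_trm_lift)
next
  case (App t u)
  show ?case using App(1)[of s k] App(2)[of s k] by auto
qed auto

lemma cstep_set_trm: "cstep t u \<Longrightarrow> set_trm u \<subseteq> set_trm t"
proof (induction rule: cstep.induct)
  case (beta u t ts)
  show ?case using set_trm_subst[of u t 0] by (auto simp: set_trm_apps)
next
  case (control t ts)
  show ?case by (auto simp: set_trm_apps set_trm_lift)
qed

section \<open>Renaming of stack constants\<close>

lemma map_trm_lift: "map_trm f (lift t k) = lift (map_trm f t) k"
  by (induction t arbitrary: k) auto

lemma map_trm_subst: "map_trm f (subst t s k) = subst (map_trm f t) (map_trm f s) k"
  by (induction t arbitrary: s k) (auto simp: map_trm_lift)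

lemma map_trm_apps: "map_trm f (apps t ts) = apps (map_trm f t) (map (map_trm f) ts)"
  by (induction ts arbitrary: t) auto

lemma map_trm_LCP: "t \<in> LCP \<Longrightarrow> map_trm f t \<in> LCP"
  by (induction t rule: LCP.induct) (auto intro: LCP.intros)

lemma map_trm_LC: "t \<in> LC \<Longrightarrow> map_trm f t = t"
  by (induction t rule: LC.induct) auto

lemma map_trm_stack:
  "set ts \<subseteq> LCP \<union> range Stk \<Longrightarrow> set (map (map_trm f) ts) \<subseteq> LCP \<union> range Stk"
  by (auto dest!: subsetD intro: map_trm_LCP)

text \<open>The rules move and copy stack constants but never compare them, so even a non-injective
  renaming \<open>f\<close> preserves steps.\<close>

lemma cstep_map_trm: "cstep t u \<Longrightarrow> cstep (map_trm f t) (map_trm f u)"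
proof (induction rule: cstep.induct)
  case (beta u t ts)
  show ?case
    using cstep.beta[OF map_trm_LCP[OF beta(1)] map_trm_LCP[OF beta(2)] map_trm_stack[OF beta(3)]]
    by (simp add: map_trm_apps map_trm_subst)
next
  case (control t ts)
  show ?case
    using cstep.control[OF map_trm_LCP[OF control(1)] map_trm_stack[OF control(2)]]
    by (simp add: map_trm_apps map_trm_lift comp_def)
qed

lemma reduces_map_trm: "t \<triangleright> u \<Longrightarrow> map_trm f t \<triangleright> map_trm f u"
  by (induction rule: rtranclp_induct) (auto intro: rtranclp.rtrancl_into_rtrancl cstep_map_trm)

section \<open>Well-formed types\<close>

lemma tsubst_tsubst: "tsubst \<sigma> (tsubst \<tau> a) = tsubst (\<lambda>i. tsubst \<sigma> (\<tau> i)) a"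
  by (induction a) auto

lemma wf_tsubst: "wf_iterm L a \<Longrightarrow> (\<And>i. wf_iterm L (\<sigma> i)) \<Longrightarrow> wf_iterm L (tsubst \<sigma> a)"
  by (induction a) (auto simp: list_all_iff)

lemma wf_tsubst_D: "wf_iterm L (tsubst \<sigma> a) \<Longrightarrow> wf_iterm L a"
  by (induction a) (auto simp: list_all_iff)

lemma wf_up: "(\<And>i. wf_iterm L (\<sigma> i)) \<Longrightarrow> wf_iterm L (up \<sigma> i)"
  by (auto simp: up_def wf_tsubst split: nat.split)

lemma wf_isubst: "wf_form L A \<Longrightarrow> (\<And>i. wf_iterm L (\<sigma> i)) \<Longrightarrow> wf_form L (isubst \<sigma> A)"
  by (induction A arbitrary: \<sigma>) (auto simp: list_all_iff wf_tsubst wf_up)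

lemma wf_isubst_D: "wf_form L (isubst \<sigma> A) \<Longrightarrow> wf_form L A"
  by (induction A arbitrary: \<sigma>) (auto simp: list_all_iff dest: wf_tsubst_D)

lemma wf_plift: "wf_form L (plift A c n k) = wf_form L A"
  by (induction A arbitrary: k) auto

lemma wf_inst: "list_all (wf_iterm L) as \<Longrightarrow> wf_iterm L (inst as i)"
  by (auto simp: inst_def list_all_length)

lemma wf_psubst: "wf_form L A \<Longrightarrow> wf_form L G \<Longrightarrow> wf_form L (psubst A c n k G)"
proof (induction A arbitrary: k G)
  case (All1 A)
  have "wf_form L (isubst (shift n) G)"
    using All1 by (intro wf_isubst) (auto simp: shift_def)
  with All1 show ?case by simp
qed (auto simp: wf_plift wf_inst intro!: wf_isubst)

section \<open>Equational entailment under substitution\<close>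

lemma eqv_wf:
  assumes "wf_equations L E" "eqv L E a b"
  shows "wf_iterm L a \<and> wf_iterm L b"
  using assms(2)
proof induction
  case (inst a b \<sigma>)
  then show ?case using assms(1) by (auto simp: wf_equations_def intro!: wf_tsubst)
next
  case (cong_Fn f as bs)
  then show ?case by (auto simp: list_all_length list_all2_conv_all_nth)
qed auto

lemma eqv_tsubst:
  assumes "eqv L E a b" "\<And>i. wf_iterm L (\<sigma> i)"
  shows "eqv L E (tsubst \<sigma> a) (tsubst \<sigma> b)"
  using assms(1)
proof induction
  case (inst a b \<tau>)
  show ?case
    using eqv.inst[OF inst(1), of L "\<lambda>i. tsubst \<sigma> (\<tau> i)"] inst(2) assms(2)
    by (simp add: wf_tsubst tsubst_tsubst)
next
  case (cong_Fn f as bs)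
  then show ?case
    by (auto intro!: eqv.cong_Fn simp: list.rel_map elim!: list.rel_mono_strong)
qed (auto intro: eqv.intros wf_tsubst assms(2))

lemma eqv_tsubst_cong:
  "wf_iterm L a \<Longrightarrow> (\<And>i. eqv L E (\<sigma> i) (\<sigma>' i)) \<Longrightarrow> eqv L E (tsubst \<sigma> a) (tsubst \<sigma>' a)"
proof (induction a)
  case (Fn f as)
  then show ?case
    by (auto intro!: eqv.cong_Fn simp: list.rel_map list_all_iff list_all2_same)
qed (auto intro: eqv.intros)

lemma M2_wf:
  assumes "wf_equations L E" "M2 L E \<Gamma> t A"
  shows "list_all (wf_form L) \<Gamma> \<and> wf_form L A"
  using assms(2)
proof induction
  case (ax \<Gamma> i)
  then show ?case by (auto simp: list_all_length)
next
  case (all1_intro \<Gamma> t A)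
  then show ?case by (auto simp: list_all_iff dest: wf_isubst_D)
next
  case (all1_elim \<Gamma> t A a)
  then show ?case by (auto intro!: wf_isubst wf_inst)
next
  case (equation \<Gamma> t a A b)
  then show ?case
    using eqv_wf[OF assms(1) equation(2)] by (auto intro!: wf_isubst wf_inst dest: wf_isubst_D)
qed (auto simp: list_all_iff wf_plift wf_psubst)

lemma M2_LC: "M2 L E \<Gamma> t A \<Longrightarrow> t \<in> LC"
  by (induction rule: M2.induct) (auto intro: LC.intros)

section \<open>Realizability\<close>

type_synonym ('f, 'p) pred = "'f iterm list \<Rightarrow> 'p trm list set"

text \<open>The environment counterpart of making room at a de Bruijn index. The position
  \<open>k\<close> is general because \<open>plift\<close> and \<open>psubst\<close> raise it under
  binders of the same sort and arity.\<close>

definition pins ::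
  "(sort \<Rightarrow> nat \<Rightarrow> nat \<Rightarrow> ('f, 'p) pred) \<Rightarrow> sort \<Rightarrow> nat \<Rightarrow> nat \<Rightarrow> ('f, 'p) pred \<Rightarrow>
    sort \<Rightarrow> nat \<Rightarrow> nat \<Rightarrow> ('f, 'p) pred" where
  "pins \<rho> c n k F = (\<lambda>d m i. if d = c \<and> m = n
     then if i < k then \<rho> d m i else if i = k then F else \<rho> d m (i - 1) else \<rho> d m i)"

lemma pins_pins:
  "pins (pins \<rho> c n k F) d m 0 G =
   pins (pins \<rho> d m 0 G) c n (if d = c \<and> m = n then Suc k else k) F"
  (is "?l = ?r")
proof (intro ext)
  show "?l e l i as = ?r e l i as" for e l i as
    by (cases "e = c \<and> l = n"; cases "e = d \<and> l = m"; cases i) (auto simp: pins_def)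
qed

locale orthogonality =
  fixes L :: "('f, 'r) language" and E :: "('f iterm \<times> 'f iterm) set"
    and pole :: "'p trm \<Rightarrow> bool"
  assumes wf_E: "wf_equations L E"
    and pole_step: "cstep e e' \<Longrightarrow> pole e' \<Longrightarrow> pole e"
begin

definition realizes :: "'p trm \<Rightarrow> 'p trm list set \<Rightarrow> bool" where
  "realizes t S \<longleftrightarrow> t \<in> LCP \<and> (\<forall>\<pi>\<in>S. pole (apps t \<pi>))"

text \<open>Invariance under \<open>eqv\<close> is what the equational rule needs; the condition on
  the stacks supplies the side conditions of \<open>cstep\<close> on the remaining
  arguments.\<close>

definition admissible :: "nat \<Rightarrow> ('f, 'p) pred \<Rightarrow> bool" where
  "admissible n F \<longleftrightarrow>
     (\<forall>as bs. length as = n \<longrightarrow> list_all2 (eqv L E) as bs \<longrightarrow> F as = F bs) \<and>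
     (\<forall>as. \<forall>\<pi>\<in>F as. set \<pi> \<subseteq> LCP \<union> range Stk)"

text \<open>Since \<open>Bot\<close> has just the empty stack, a realizer of \<open>Neg A\<close> is
  a term of \<open>LCP\<close> that sends realizers of \<open>A\<close> into the pole. Since
  \<open>Rel\<close> has no stacks, every term of \<open>LCP\<close> realizes it.\<close>

primrec stacks ::
  "('f, 'r) form \<Rightarrow> (sort \<Rightarrow> nat \<Rightarrow> nat \<Rightarrow> ('f, 'p) pred) \<Rightarrow> (nat \<Rightarrow> 'f iterm) \<Rightarrow> 'p trm list set"
where
  "stacks Bot \<rho> \<sigma> = {[]}"
| "stacks (PVar c i as) \<rho> \<sigma> = \<rho> c (length as) i (map (tsubst \<sigma>) as)"
| "stacks (Rel R as) \<rho> \<sigma> = {}"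
| "stacks (Imp A B) \<rho> \<sigma> = {t # \<pi> | t \<pi>. realizes t (stacks A \<rho> \<sigma>) \<and> \<pi> \<in> stacks B \<rho> \<sigma>}"
| "stacks (All1 A) \<rho> \<sigma> = (\<Union>a\<in>{a. wf_iterm L a}. stacks A \<rho> (case_nat a \<sigma>))"
| "stacks (All2 c n A) \<rho> \<sigma> = (\<Union>F\<in>{F. admissible n F}. stacks A (pins \<rho> c n 0 F) \<sigma>)"

definition valuation :: "(sort \<Rightarrow> nat \<Rightarrow> nat \<Rightarrow> ('f, 'p) pred) \<Rightarrow> bool" where
  "valuation \<rho> \<longleftrightarrow> (\<forall>c n i. admissible n (\<rho> c n i))"

lemma valuation_pins: "valuation \<rho> \<Longrightarrow> admissible n F \<Longrightarrow> valuation (pins \<rho> c n k F)"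
  by (auto simp: valuation_def pins_def)

section \<open>Substitution lemmas for the interpretation of types\<close>

lemma stacks_isubst: "stacks (isubst \<tau> A) \<rho> \<sigma> = stacks A \<rho> (\<lambda>i. tsubst \<sigma> (\<tau> i))"
proof (induction A arbitrary: \<tau> \<sigma> \<rho>)
  case (All1 A)
  have "(\<lambda>i. tsubst (case_nat a \<sigma>) (up \<tau> i)) = case_nat a (\<lambda>i. tsubst \<sigma> (\<tau> i))" for a
    by (auto simp: up_def tsubst_tsubst fun_eq_iff split: nat.split)
  then show ?case by (simp add: All1)
qed (auto simp: tsubst_tsubst comp_def)

lemma stacks_plift: "stacks (plift A c n k) (pins \<rho> c n k F) \<sigma> = stacks A \<rho> \<sigma>"
proof (induction A arbitrary: k \<rho> \<sigma>)
  case (All2 d m A)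
  show ?case by (simp only: plift.simps stacks.simps pins_pins All2)
qed (auto simp: pins_def)

text \<open>This turns second-order elimination into an instantiation of the quantified
  \<open>F\<close>. The environment of \<open>G\<close> mirrors \<open>inst\<close>: arguments
  first, then the old variables; \<open>shift\<close> and \<open>plift\<close> keep the meaning of
  \<open>G\<close> fixed under binders.\<close>

lemma stacks_psubst:
  "stacks (psubst A c n k G) \<rho> \<sigma> =
   stacks A (pins \<rho> c n k (\<lambda>as. stacks G \<rho> (\<lambda>i. if i < n then as ! i else \<sigma> (i - n)))) \<sigma>"
proof (induction A arbitrary: k G \<rho> \<sigma>)
  case (PVar d i as)
  have "length as = n \<Longrightarrow> (\<lambda>i. tsubst \<sigma> (inst as i)) =
      (\<lambda>i. if i < n then map (tsubst \<sigma>) as ! i else \<sigma> (i - n))"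
    by (auto simp: inst_def fun_eq_iff)
  then show ?case by (auto simp: pins_def stacks_isubst)
next
  case (All1 A)
  have "(\<lambda>i. tsubst (\<lambda>i. if i < n then as ! i else case_nat a \<sigma> (i - n)) (shift n i)) =
      (\<lambda>i. if i < n then as ! i else \<sigma> (i - n))" for as a
    by (auto simp: shift_def fun_eq_iff Suc_diff_le)
  then show ?case by (simp add: All1 stacks_isubst)
next
  case (All2 d m A)
  show ?case by (simp only: psubst.simps stacks.simps All2 stacks_plift pins_pins)
qed auto

lemma stacks_cong:
  "wf_form L A \<Longrightarrow> valuation \<rho> \<Longrightarrow> (\<And>i. eqv L E (\<sigma> i) (\<sigma>' i)) \<Longrightarrow>
   stacks A \<rho> \<sigma> = stacks A \<rho> \<sigma>'"
proof (induction A arbitrary: \<rho> \<sigma> \<sigma>')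
  case (PVar c i as)
  have "list_all2 (eqv L E) (map (tsubst \<sigma>) as) (map (tsubst \<sigma>') as)"
    using PVar by (auto simp: list.rel_map list_all_iff intro!: list.rel_refl_strong eqv_tsubst_cong)
  moreover have "admissible (length as) (\<rho> c (length as) i)"
    using PVar by (auto simp: valuation_def)
  ultimately show ?case by (auto simp: admissible_def)
next
  case (Imp A B)
  have "stacks A \<rho> \<sigma> = stacks A \<rho> \<sigma>'" "stacks B \<rho> \<sigma> = stacks B \<rho> \<sigma>'"
    using Imp by auto
  then show ?case by simp
next
  case (All1 A)
  have "stacks A \<rho> (case_nat a \<sigma>) = stacks A \<rho> (case_nat a \<sigma>')" if "wf_iterm L a" for a
    using All1 that by (intro All1.IH) (auto intro: eqv.refl split: nat.split)
  then show ?case by auto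
next
  case (All2 d m A)
  have "stacks A (pins \<rho> d m 0 F) \<sigma> = stacks A (pins \<rho> d m 0 F) \<sigma>'" if "admissible m F" for F
    using All2 that by (intro All2.IH) (auto intro: valuation_pins)
  then show ?case by auto
qed auto

lemma stacks_valid: "valuation \<rho> \<Longrightarrow> \<pi> \<in> stacks A \<rho> \<sigma> \<Longrightarrow> set \<pi> \<subseteq> LCP \<union> range Stk"
proof (induction A arbitrary: \<rho> \<sigma> \<pi>)
  case (PVar c i as)
  then have "admissible (length as) (\<rho> c (length as) i)" by (simp add: valuation_def)
  with PVar(2) show ?case by (auto simp: admissible_def)
next
  case (Imp A B)
  then obtain t \<pi>' where "\<pi> = t # \<pi>'" "t \<in> LCP" "\<pi>' \<in> stacks B \<rho> \<sigma>"
    by (auto simp: realizes_def)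
  with Imp show ?case by simp
next
  case (All1 A)
  then show ?case by auto
next
  case (All2 d m A)
  then obtain F where "admissible m F" "\<pi> \<in> stacks A (pins \<rho> d m 0 F) \<sigma>" by auto
  with All2 show ?case by (blast intro: valuation_pins)
qed auto

text \<open>Comprehension: a well-formed formula denotes a predicate over which the second-order
  quantifiers range.\<close>

lemma admissible_stacks:
  assumes "wf_form L G" "valuation \<rho>" "\<And>i. wf_iterm L (\<sigma> i)"
  shows "admissible n (\<lambda>as. stacks G \<rho> (\<lambda>i. if i < n then as ! i else \<sigma> (i - n)))"
  unfolding admissible_def
proof (intro conjI allI impI ballI)
  fix as bs :: "'f iterm list"
  assume "length as = n" "list_all2 (eqv L E) as bs"
  then show "stacks G \<rho> (\<lambda>i. if i < n then as ! i else \<sigma> (i - n)) =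
      stacks G \<rho> (\<lambda>i. if i < n then bs ! i else \<sigma> (i - n))"
    using assms by (intro stacks_cong) (auto simp: list_all2_conv_all_nth intro: eqv.refl)
next
  fix as \<pi>
  assume "\<pi> \<in> stacks G \<rho> (\<lambda>i. if i < n then as ! i else \<sigma> (i - n))"
  then show "set \<pi> \<subseteq> LCP \<union> range Stk" by (rule stacks_valid[OF assms(2)])
qed

lemma realizes_UN: "t \<in> LCP \<Longrightarrow> (\<And>i. i \<in> I \<Longrightarrow> realizes t (S i)) \<Longrightarrow> realizes t (\<Union>i\<in>I. S i)"
  by (auto simp: realizes_def)

text \<open>The control rule hands to \<open>t\<close> a continuation storing the current stack.
  This continuation realizes \<open>Neg A\<close>, because applying it to a realizer of
  \<open>A\<close> reinstates that stack in one beta step.\<close>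

lemma Cc_realizes:
  assumes "valuation \<rho>"
  shows "realizes Cc (stacks (Imp (Neg (Neg A)) A) \<rho> \<sigma>)"
  unfolding realizes_def
proof (intro conjI ballI)
  show "Cc \<in> LCP" by (rule LCP.intros)
  fix \<pi> assume "\<pi> \<in> stacks (Imp (Neg (Neg A)) A) \<rho> \<sigma>"
  then obtain t \<pi>' where \<pi>: "\<pi> = t # \<pi>'" and t: "realizes t (stacks (Neg (Neg A)) \<rho> \<sigma>)"
    and \<pi>': "\<pi>' \<in> stacks A \<rho> \<sigma>"
    by auto
  have v: "set \<pi>' \<subseteq> LCP \<union> range Stk" using stacks_valid[OF assms \<pi>'] .
  let ?k = "apps (Var 0) (map (\<lambda>u. lift u 0) \<pi>')"
  have k: "?k \<in> LCP"
  proof (intro apps_LCP)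
    show "set (map (\<lambda>u. lift u 0) \<pi>') \<subseteq> LCP \<union> range Stk"
      using v by (auto dest!: subsetD intro: lift_LCP)
  qed (rule LCP.intros)
  \<comment> \<open>The stored stack was lifted, so the substitution affects only the head and gives
    the stack back unchanged.\<close>
  have "subst (apps s (map (\<lambda>u. lift u 0) ts)) u 0 = apps (subst s u 0) ts" for s u :: "'p trm" and ts
    by (induction ts arbitrary: s) (auto simp: subst_lift)
  then have "pole (App (Lam ?k) u)" if "realizes u (stacks A \<rho> \<sigma>)" for u
    using pole_step[OF cstep.beta[OF k, of u "[]"]] that \<pi>' by (auto simp: realizes_def)
  then have "realizes (Lam ?k) (stacks (Neg A) \<rho> \<sigma>)"
    using k by (auto simp: realizes_def intro: LCP.intros)
  then have "pole (App t (Lam ?k))" using t by (auto simp: realizes_def)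
  moreover have "cstep (apps Cc \<pi>) (App t (Lam ?k))"
    using cstep.control[of t \<pi>'] t v by (simp add: \<pi> realizes_def)
  ultimately show "pole (apps Cc \<pi>)" by (rule pole_step[rotated])
qed

text \<open>All three environments are universally quantified, since introduction rules extend them:
  arrow introduction extends \<open>\<tau>\<close>, first-order generalization
  \<open>\<sigma>\<close>, second-order generalization \<open>\<rho>\<close>.\<close>

theorem adequacy:
  assumes "M2 L E \<Gamma> t A" "valuation \<rho>" "\<forall>i. wf_iterm L (\<sigma> i)" "\<forall>i. \<tau> i \<in> LCP"
    and "\<forall>i<length \<Gamma>. realizes (\<tau> i) (stacks (\<Gamma> ! i) \<rho> \<sigma>)"
  shows "realizes (psub \<tau> t) (stacks A \<rho> \<sigma>)"
  using assms
proof (induction arbitrary: \<rho> \<sigma> \<tau> rule: M2.induct)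
  case (ax \<Gamma> i)
  then show ?case by simp
next
  case (imp_intro A \<Gamma> t B)
  let ?t = "psub (case_nat (Var 0) (\<lambda>i. lift (\<tau> i) 0)) t"
  have t: "?t \<in> LCP"
    using M2_LC[OF imp_intro(1)] imp_intro(5)
    by (auto intro!: LCP_psub LCP.intros lift_LCP split: nat.split)
  have "pole (apps (App (Lam ?t) u) \<pi>)"
    if u: "realizes u (stacks A \<rho> \<sigma>)" and \<pi>: "\<pi> \<in> stacks B \<rho> \<sigma>" for u \<pi>
  proof (rule pole_step)
    have u': "u \<in> LCP" using u by (simp add: realizes_def)
    show "cstep (apps (App (Lam ?t) u) \<pi>) (apps (subst ?t u 0) \<pi>)"
      using t u' stacks_valid[OF imp_intro(3) \<pi>] by (rule cstep.beta)
    have "realizes (psub (case_nat u \<tau>) t) (stacks B \<rho> \<sigma>)"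
      using imp_intro(3-6) u u'
      by (intro imp_intro.IH) (auto simp: nth_Cons split: nat.split)
    then show "pole (apps (subst ?t u 0) \<pi>)"
      using \<pi> by (simp add: subst_psub_0 realizes_def)
  qed
  then show ?case using t by (auto simp: realizes_def intro: LCP.intros)
next
  case (imp_elim \<Gamma> t A B u)
  have "realizes (psub \<tau> t) (stacks (Imp A B) \<rho> \<sigma>)" "realizes (psub \<tau> u) (stacks A \<rho> \<sigma>)"
    using imp_elim by blast+
  moreover have "psub \<tau> u # \<pi> \<in> stacks (Imp A B) \<rho> \<sigma>" if "\<pi> \<in> stacks B \<rho> \<sigma>" for \<pi>
    using that \<open>realizes (psub \<tau> u) _\<close> by simp
  ultimately have "pole (apps (psub \<tau> t) (psub \<tau> u # \<pi>))" if "\<pi> \<in> stacks B \<rho> \<sigma>" for \<pi>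
    using that unfolding realizes_def[of "psub \<tau> t"] by blast
  moreover have "App (psub \<tau> t) (psub \<tau> u) \<in> LCP"
    using \<open>realizes (psub \<tau> t) _\<close> \<open>realizes (psub \<tau> u) _\<close>
    by (auto simp: realizes_def intro: LCP.intros)
  ultimately show ?case by (simp add: realizes_def)
next
  case (all1_intro \<Gamma> t A)
  have "realizes (psub \<tau> t) (stacks A \<rho> (case_nat a \<sigma>))" if "wf_iterm L a" for a
    using all1_intro(3-6) that
    by (intro all1_intro.IH) (auto simp: stacks_isubst shift_def split: nat.split)
  then show ?case using M2_LC[OF all1_intro(1)] all1_intro(5) by (auto simp: realizes_def LCP_psub)
next
  case (all1_elim \<Gamma> t A a)
  have "(\<lambda>i. tsubst \<sigma> (inst [a] i)) = case_nat (tsubst \<sigma> a) \<sigma>"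
    by (auto simp: inst_def fun_eq_iff split: nat.split)
  moreover have "realizes (psub \<tau> t) (stacks (All1 A) \<rho> \<sigma>)" using all1_elim by blast
  moreover have "wf_iterm L (tsubst \<sigma> a)" using all1_elim by (blast intro: wf_tsubst)
  ultimately show ?case by (auto simp: stacks_isubst realizes_def)
next
  case (all2_intro n \<Gamma> t A)
  have "realizes (psub \<tau> t) (stacks A (pins \<rho> Ordinary n 0 F) \<sigma>)" if "admissible n F" for F
    using all2_intro(3-6) that
    by (intro all2_intro.IH) (auto simp: stacks_plift valuation_pins)
  then show ?case using M2_LC[OF all2_intro(1)] all2_intro(5) by (auto simp: realizes_def LCP_psub)
next
  case (all2_elim \<Gamma> t n A G)
  have "realizes (psub \<tau> t) (stacks (All2 Ordinary n A) \<rho> \<sigma>)" using all2_elim by blast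
  then show ?case
    using admissible_stacks[of G \<rho> \<sigma> n] all2_elim by (auto simp: stacks_psubst realizes_def)
next
  case (equation \<Gamma> t a A b)
  \<comment> \<open>The two environments differ only at index 0, where they hold equivalent terms,
    so \<open>stacks_cong\<close> applies; well-formedness of \<open>A\<close> is recovered from the
    derivation.\<close>
  have "eqv L E (tsubst \<sigma> (inst [a] i)) (tsubst \<sigma> (inst [b] i))" for i
    using equation eqv_tsubst[OF equation(2)] by (auto simp: inst_def intro: eqv.refl)
  then have "stacks (isubst (inst [a]) A) \<rho> \<sigma> = stacks (isubst (inst [b]) A) \<rho> \<sigma>"
    unfolding stacks_isubst using M2_wf[OF wf_E equation(1)] equation(4)
    by (intro stacks_cong) (auto dest: wf_isubst_D)
  moreover have "realizes (psub \<tau> t) (stacks (isubst (inst [a]) A) \<rho> \<sigma>)"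
    using equation by blast
  ultimately show ?case by simp
next
  case (control \<Gamma>)
  have "realizes Cc (stacks (Imp (Neg (Neg B)) B) (pins \<rho> Classical 0 0 F) \<sigma>)"
    if "admissible 0 F" for F and B :: "('f, 'r) form"
    using control that by (intro Cc_realizes valuation_pins)
  then show ?case
    unfolding psub.simps stacks.simps(6)
    by (intro realizes_UN LCP.intros) (simp only: mem_Collect_eq)
next
  case (allC_intro n \<Gamma> t A)
  have "realizes (psub \<tau> t) (stacks A (pins \<rho> Classical n 0 F) \<sigma>)" if "admissible n F" for F
    using allC_intro(3-6) that
    by (intro allC_intro.IH) (auto simp: stacks_plift valuation_pins)
  then show ?case using M2_LC[OF allC_intro(1)] allC_intro(5) by (auto simp: realizes_def LCP_psub)
next
  case (allC_elim \<Gamma> t n A G)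
  have "realizes (psub \<tau> t) (stacks (All2 Classical n A) \<rho> \<sigma>)" using allC_elim by blast
  then show ?case
    using admissible_stacks[of G \<rho> \<sigma> n] allC_elim by (auto simp: stacks_psubst realizes_def)
qed

end

section \<open>Runs of classical integers\<close>

text \<open>The premise of \<open>call\<close> demands every \<open>j\<close>, which leaves its
  choice to the later unfolding; the \<open>j'\<close> on top at the call is arbitrary.\<close>

inductive run_pole :: "nat \<Rightarrow> nat \<Rightarrow> (nat \<times> nat \<Rightarrow> 'p) \<Rightarrow> 'p trm \<Rightarrow> bool" for x g c where
  base: "run_pole x g c (App (Var x) (Stk (c (0, j))))"
| call: "t \<in> LCP \<Longrightarrow> (\<And>j. run_pole x g c (App t (Stk (c (l, j))))) \<Longrightarrow>
    run_pole x g c (App (App (Var g) t) (Stk (c (Suc l, j'))))"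
| step: "cstep e e' \<Longrightarrow> run_pole x g c e' \<Longrightarrow> run_pole x g c e"

text \<open>Adequacy lets successors be peeled off both sides until one side is 0. It ensures that
  only constants of level 0 stand for \<open>X(0)\<close>.\<close>

lemma eqv_numerals:
  assumes "adequate L E" "eqv L E ((Succ ^^ k) Zero) ((Succ ^^ l) Zero)"
  shows "k = l"
proof -
  have wf: "wf_iterm L ((Succ ^^ i) Zero)" for i by (induction i) auto
  show ?thesis using assms(2)
  proof (induction k arbitrary: l)
    case 0
    then show ?case using assms(1) wf by (cases l) (auto simp: adequate_def dest: eqv.sym)
  next
    case (Suc k)
    then show ?case using assms(1) wf by (cases l) (auto simp: adequate_def)
  qed
qed

lemma run_pole_NC:
  fixes \<theta> :: "'p trm" and E :: "('f iterm \<times> 'f iterm) set" and L :: "('f, 'r) language"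
  assumes "wf_equations L E" and ad: "adequate L E"
    and der: "M2 L E [] \<theta> (NC ((Succ ^^ n) Zero))"
  shows "run_pole x g c (App (App (App \<theta> (Var x)) (Var g)) (Stk (c (n, j))))"
proof -
  interpret orthogonality L E "run_pole x g c"
    using assms(1) by unfold_locales (auto intro: run_pole.step)
  have wf: "wf_iterm L ((Succ ^^ i) Zero)" for i by (induction i) auto
  have num: "tsubst \<sigma> ((Succ ^^ i) Zero) = (Succ ^^ i) Zero" for \<sigma> :: "nat \<Rightarrow> 'f iterm" and i
    by (induction i) auto
  define F :: "('f, 'p) pred" where
    "F as = {[Stk (c (k, j))] | k j. eqv L E (as ! 0) ((Succ ^^ k) Zero)}" for as
  have F: "admissible 1 F"
    unfolding admissible_def
  proof (intro conjI allI impI)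
    fix as bs :: "'f iterm list"
    assume "length as = 1" "list_all2 (eqv L E) as bs"
    then have "eqv L E (as ! 0) (bs ! 0)" by (auto simp: list_all2_conv_all_nth)
    then have "eqv L E (as ! 0) d \<longleftrightarrow> eqv L E (bs ! 0) d" for d
      by (blast intro: eqv.sym eqv.trans)
    then show "F as = F bs" by (simp add: F_def)
  qed (auto simp: F_def)
  \<comment> \<open>The type of \<open>\<theta>\<close> has no free predicate variables, so any
    valuation serves; the empty one is trivially admissible.\<close>
  define \<rho> :: "sort \<Rightarrow> nat \<Rightarrow> nat \<Rightarrow> ('f, 'p) pred" where "\<rho> = (\<lambda>_ _ _ _. {})"
  have "valuation \<rho>" by (simp add: valuation_def admissible_def \<rho>_def)
  then have "realizes (psub Var \<theta>) (stacks (NC ((Succ ^^ n) Zero) :: ('f, 'r) form) \<rho> IVar)"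
    by (intro adequacy[OF der]) (auto intro: LCP.intros)
  then have \<theta>: "realizes \<theta> (stacks (NC ((Succ ^^ n) Zero) :: ('f, 'r) form) \<rho> IVar)"
    by (simp only: psub_Var)
  have "realizes (Var x) (F [Zero])"
  proof -
    have "k = 0" if "eqv L E Zero ((Succ ^^ k) Zero)" for k
      using eqv_numerals[OF ad, of 0 k] that by simp
    then have "run_pole x g c (apps (Var x) \<pi>)" if "\<pi> \<in> F [Zero]" for \<pi>
      using that by (fastforce simp: F_def intro: run_pole.base)
    then show ?thesis by (simp add: realizes_def LCP.intros)
  qed
  \<comment> \<open>By adequacy of \<open>E\<close>, \<open>k\<close> is some \<open>Suc l\<close>
    and \<open>a\<close> is equivalent to the numeral of \<open>l\<close>; then \<open>t\<close>
    realizing \<open>F [a]\<close> gives the premise of \<open>call\<close> for all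
    \<open>j\<close>.\<close>
  moreover have "run_pole x g c (App (App (Var g) t) (Stk (c (k, j))))"
    if "wf_iterm L a" "realizes t (F [a])" "eqv L E (Succ a) ((Succ ^^ k) Zero)" for a t k j
  proof (cases k)
    case 0
    with that ad show ?thesis by (auto simp: adequate_def)
  next
    case (Suc l)
    then have "eqv L E a ((Succ ^^ l) Zero)" using that ad wf by (auto simp: adequate_def)
    then have "[Stk (c (l, i))] \<in> F [a]" for i by (auto simp: F_def)
    then have "run_pole x g c (apps t [Stk (c (l, i))])" for i
      using that(2) unfolding realizes_def by blast
    then show ?thesis using that(2) by (auto simp: Suc realizes_def intro!: run_pole.call)
  qed
  then have "realizes (Var g) {t # \<pi> | a t \<pi>. wf_iterm L a \<and> realizes t (F [a]) \<and> \<pi> \<in> F [Succ a]}"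
    by (auto simp: realizes_def[of "Var g"] F_def intro: LCP.intros)
  then have "realizes (Var g)
      (\<Union>a\<in>{a. wf_iterm L a}. {t # \<pi> | t \<pi>. realizes t (F [a]) \<and> \<pi> \<in> F [Succ a]})"
    by (rule back_subst[of "realizes (Var g)"]) auto
  moreover have "[Stk (c (n, j))] \<in> F [(Succ ^^ n) Zero]"
    by (auto simp: F_def intro: eqv.refl wf)
  ultimately have "[Var x, Var g, Stk (c (n, j))] \<in> stacks (Imp (PVar Classical 0 [Zero])
      (Imp (All1 (Imp (PVar Classical 0 [IVar 0]) (PVar Classical 0 [Succ (IVar 0)])))
        (PVar Classical 0 [(Succ ^^ n) Zero]) :: ('f, 'r) form)) (pins \<rho> Classical 1 0 F) IVar"
    by (simp add: pins_def num)
  then have "[Var x, Var g, Stk (c (n, j))] \<in>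
      stacks (NC ((Succ ^^ n) Zero) :: ('f, 'r) form) \<rho> IVar"
    unfolding NC_def stacks.simps(6) using F by blast
  then have "run_pole x g c (apps \<theta> [Var x, Var g, Stk (c (n, j))])"
    using \<theta> unfolding realizes_def by blast
  then show ?thesis by simp
qed

text \<open>The run continues from \<open>e\<close> after the constants \<open>c (q 0), \<dots>, c (q k)\<close> have been supplied.\<close>

lemma run_pole_run:
  assumes "run_pole x g c e" "inj c" "inj_on q {0..k}" "set_trm e \<subseteq> c ` q ` {0..k}"
  shows "\<exists>m q' t r. k \<le> m \<and> (\<forall>i\<le>k. q' i = q i) \<and> inj_on q' {0..m} \<and>
    (\<forall>i. k \<le> i \<and> i \<le> m \<longrightarrow> r i \<le> i) \<and>
    (\<forall>i. k < i \<and> i \<le> m \<longrightarrow> t i \<in> LCP) \<and>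
    (\<forall>i. k \<le> i \<and> i \<le> m \<longrightarrow> (if i = k then e else App (t i) (Stk (c (q' i)))) \<triangleright>
       App (if i < m then App (Var g) (t (Suc i)) else Var x) (Stk (c (q' (r i))))) \<and>
    (\<forall>i. k \<le> i \<and> i < m \<longrightarrow> fst (q' (r i)) = Suc (fst (q' (Suc i)))) \<and>
    fst (q' (r m)) = 0"
  using assms(1,3,4)
proof (induction arbitrary: k q)
  case (base j)
  \<comment> \<open>The constant on top is among those supplied, and injectivity of \<open>c\<close>
    identifies its index. The run stops with \<open>m = k\<close>, so no \<open>t\<close> is
    constrained and \<open>undefined\<close> serves.\<close>
  then obtain i where "i \<le> k" "q i = (0, j)" using assms(2) by (auto dest: injD)
  with base show ?case
    by (intro exI[of _ k] exI[of _ q] exI[of _ undefined] exI[of _ "\<lambda>_. i"]) auto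
next
  case (call t l j')
  then obtain i0 where i0: "i0 \<le> k" "q i0 = (Suc l, j')" using assms(2) by (auto dest: injD)
  have "finite (snd ` q ` {0..k})" by simp
  \<comment> \<open>Avoiding all earlier second components makes \<open>(l, j)\<close> new, so the
    extended numbering stays injective.\<close>
  then obtain j where j: "j \<notin> snd ` q ` {0..k}" using ex_new_if_finite infinite_UNIV_nat by blast
  define q1 where "q1 = q(Suc k := (l, j))"
  have q1: "q1 i = q i" if "i \<le> k" for i using that by (simp add: q1_def)
  have im: "q1 ` {0..Suc k} = insert (l, j) (q ` {0..k})"
    by (auto simp: q1_def atLeast0_atMost_Suc)
  have "(l, j) \<notin> q ` {0..k}" using j image_eqI[of j snd "(l, j)" "q ` {0..k}"] by auto
  then have "inj_on q1 {0..Suc k}"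
    using call(4) by (auto simp: q1_def atLeast0_atMost_Suc inj_on_fun_updI)
  moreover have "set_trm (App t (Stk (c (l, j)))) \<subseteq> c ` q1 ` {0..Suc k}"
    using call(5) by (auto simp: im)
  ultimately obtain m q' t' r where m: "Suc k \<le> m" and q': "\<forall>i\<le>Suc k. q' i = q1 i"
    and inj: "inj_on q' {0..m}" and r: "\<forall>i. Suc k \<le> i \<and> i \<le> m \<longrightarrow> r i \<le> i"
    and t': "\<forall>i. Suc k < i \<and> i \<le> m \<longrightarrow> t' i \<in> LCP"
    and run: "\<forall>i. Suc k \<le> i \<and> i \<le> m \<longrightarrow>
       (if i = Suc k then App t (Stk (c (l, j))) else App (t' i) (Stk (c (q' i)))) \<triangleright>
       App (if i < m then App (Var g) (t' (Suc i)) else Var x) (Stk (c (q' (r i))))"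
    and I: "\<forall>i. Suc k \<le> i \<and> i < m \<longrightarrow> fst (q' (r i)) = Suc (fst (q' (Suc i)))"
    and I0: "fst (q' (r m)) = 0"
    using call(3)[of q1 "Suc k" j] by blast
  have q'k: "q' (Suc k) = (l, j)" "q' i0 = (Suc l, j')"
    using q' i0 q1 by (auto simp: q1_def)
  \<comment> \<open>The induction hypothesis leaves \<open>t'\<close> at \<open>Suc k\<close> and
    \<open>r\<close> at \<open>k\<close> unconstrained; they now receive the argument of this call
    and the index at which its top constant was supplied.\<close>
  let ?t = "t'(Suc k := t)" and ?r = "r(k := i0)"
  have "(if i = k then App (App (Var g) t) (Stk (c (Suc l, j'))) else App (?t i) (Stk (c (q' i)))) \<triangleright>
       App (if i < m then App (Var g) (?t (Suc i)) else Var x) (Stk (c (q' (?r i))))"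
    if "k \<le> i" "i \<le> m" for i
  proof (cases "i = k")
    case True
    then show ?thesis using m q'k by simp
  next
    case False
    have "(if i = Suc k then App t (Stk (c (l, j))) else App (t' i) (Stk (c (q' i)))) =
        App (?t i) (Stk (c (q' i)))"
      using q'k by simp
    moreover have "?t (Suc i) = t' (Suc i)" "?r i = r i" "Suc k \<le> i"
      using False that by auto
    ultimately show ?thesis
      using run[rule_format, of i] False that by (simp only: if_False simp_thms)
  qed
  moreover have "fst (q' (?r i)) = Suc (fst (q' (Suc i)))" if "k \<le> i" "i < m" for i
    using that I q'k by (cases "i = k") auto
  ultimately show ?case
    using m q' q1 inj r t' I0 i0 call(1)
    by (intro exI[of _ m] exI[of _ q'] exI[of _ ?t] exI[of _ ?r]) auto
next
  case (step e e')
  have "set_trm e' \<subseteq> c ` q ` {0..k}" using cstep_set_trm[OF step(1)] step(5) by blast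
  from step(3)[OF step(4) this] obtain m q' t r where
    "k \<le> m" "\<forall>i\<le>k. q' i = q i" "inj_on q' {0..m}" "\<forall>i. k \<le> i \<and> i \<le> m \<longrightarrow> r i \<le> i"
    "\<forall>i. k < i \<and> i \<le> m \<longrightarrow> t i \<in> LCP"
    and run: "\<forall>i. k \<le> i \<and> i \<le> m \<longrightarrow> (if i = k then e' else App (t i) (Stk (c (q' i)))) \<triangleright>
       App (if i < m then App (Var g) (t (Suc i)) else Var x) (Stk (c (q' (r i))))"
    and "\<forall>i. k \<le> i \<and> i < m \<longrightarrow> fst (q' (r i)) = Suc (fst (q' (Suc i)))" "fst (q' (r m)) = 0"
    by blast
  \<comment> \<open>Only the segment at \<open>k\<close> starts from \<open>e\<close>; the new step
    is prepended there.\<close>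
  moreover have "(if i = k then e else App (t i) (Stk (c (q' i)))) \<triangleright>
       App (if i < m then App (Var g) (t (Suc i)) else Var x) (Stk (c (q' (r i))))"
    if "k \<le> i" "i \<le> m" for i
    using run[rule_format, of i] that step(1)
    by (cases "i = k") (simp_all add: converse_rtranclp_into_rtranclp)
  ultimately show ?case
    by (intro exI[of _ m] exI[of _ q'] exI[of _ t] exI[of _ r] conjI allI impI) simp_all
qed

theorem theorem5p6:
  fixes L :: "('f, 'r) language" and E :: "('f iterm \<times> 'f iterm) set"
    and n :: nat and \<theta> :: "'p trm" and x g :: nat
  assumes "infinite (UNIV :: 'p set)"
    and "wf_equations L E" and "adequate L E"
    and "\<theta> \<in> LC" and "closed_trm \<theta>"
    and "M2 L E [] \<theta> (NC ((Succ ^^ n) Zero))"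
    and "x \<noteq> g"
  shows "(n = 0 \<longrightarrow>
           (\<forall>p. App (App (App \<theta> (Var x)) (Var g)) (Stk p) \<triangleright> App (Var x) (Stk p))) \<and>
         (n \<noteq> 0 \<longrightarrow>
           (\<exists>(m::nat) (r :: nat \<Rightarrow> nat) (I :: nat \<Rightarrow> nat).
              m \<ge> 1 \<and> (\<forall>i\<le>m. r i \<le> m) \<and>
              I 0 = n \<and> I (r m) = 0 \<and> (\<forall>i<m. int (I (i + 1)) = int (I (r i)) - 1) \<and>
              (\<forall>p :: nat \<Rightarrow> 'p. inj_on p {0..m} \<longrightarrow>
                 (\<exists>t :: nat \<Rightarrow> 'p trm.
                    (\<forall>i\<in>{1..m}. t i \<in> LCP) \<and>
                    App (App (App \<theta> (Var x)) (Var g)) (Stk (p 0))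
                      \<triangleright> App (App (Var g) (t 1)) (Stk (p (r 0))) \<and>
                    (\<forall>i. 1 \<le> i \<and> i < m \<longrightarrow>
                       App (t i) (Stk (p i)) \<triangleright> App (App (Var g) (t (i + 1))) (Stk (p (r i)))) \<and>
                    App (t m) (Stk (p m)) \<triangleright> App (Var x) (Stk (p (r m)))))))"
proof -
  let ?e = "\<lambda>p. App (App (App \<theta> (Var x)) (Var g)) (Stk p)"
  obtain c0 :: "nat \<Rightarrow> 'p" where "inj c0"
    using infinite_countable_subset[OF assms(1)] by auto
  then have "inj (c0 \<circ> prod_encode)"
    by (intro inj_compose inj_prod_encode)
  then obtain c :: "nat \<times> nat \<Rightarrow> 'p" where c: "inj c" by blast
  have no_stk: "set_trm t = {}" if "t \<in> LC" for t :: "'p trm"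
    using that by induction auto
  \<comment> \<open>As \<open>\<theta>\<close> contains no stack constants, the run starts with
    \<open>c (n, 0)\<close> alone, numbered 0.\<close>
  have "set_trm (?e (c (n, 0))) \<subseteq> c ` (\<lambda>_. (n, 0)) ` {0..0::nat}"
    and "inj_on (\<lambda>_. (n, 0::nat)) {0..0::nat}"
    using no_stk[OF assms(4)] by auto
  from run_pole_run[OF run_pole_NC[OF assms(2,3,6), of x g c 0] c this(2,1)]
  obtain m q t r where q0': "\<forall>i\<le>0. q i = (n, 0)" and inj: "inj_on q {0..m}"
    and r': "\<forall>i. 0 \<le> i \<and> i \<le> m \<longrightarrow> r i \<le> i" and t: "\<forall>i. 0 < i \<and> i \<le> m \<longrightarrow> t i \<in> LCP"
    and run: "\<forall>i. 0 \<le> i \<and> i \<le> m \<longrightarrow>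
       (if i = 0 then ?e (c (n, 0)) else App (t i) (Stk (c (q i)))) \<triangleright>
       App (if i < m then App (Var g) (t (Suc i)) else Var x) (Stk (c (q (r i))))"
    and I: "\<forall>i. 0 \<le> i \<and> i < m \<longrightarrow> fst (q (r i)) = Suc (fst (q (Suc i)))"
    and I0: "fst (q (r m)) = 0"
    by (elim exE conjE) (rule that)
  have q0: "q 0 = (n, 0)" using q0' by simp
  have inj_cq: "inj_on (c \<circ> q) {0..m}"
    by (rule comp_inj_on[OF inj inj_on_subset[OF c subset_UNIV]])
  \<comment> \<open>For each family \<open>p\<close>, the renaming \<open>f p\<close> sends the i-th
    constant of the run at \<open>c\<close> to \<open>p i\<close>.\<close>
  define f where "f p y = p (inv_into {0..m} (c \<circ> q) y)" for p :: "nat \<Rightarrow> 'p" and y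
  have f: "f p (c (q i)) = p i" if "i \<le> m" for p i
    using inv_into_f_f[OF inj_cq, of i] that by (simp add: f_def)
  have r: "r i \<le> m" if "i \<le> m" for i
    using r' that by (meson le_trans zero_le)
  have r0: "r 0 = 0"
    using r'[rule_format, of 0] by simp
  have run': "(if i = 0 then ?e (p 0) else App (map_trm (f p) (t i)) (Stk (p i))) \<triangleright>
       App (if i < m then App (Var g) (map_trm (f p) (t (Suc i))) else Var x) (Stk (p (r i)))"
    if "i \<le> m" for p i
    using reduces_map_trm[OF run[rule_format, OF conjI[OF le0 that]], of "f p"]
      f[of 0 p] f[OF that] f[OF r[OF that], of p] q0 map_trm_LC[OF assms(4)] by (cases "i = 0"; cases "i < m") simp_all
  show ?thesis
  proof (intro conjI impI)
    assume "n = 0"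
    \<comment> \<open>A call of \<open>g\<close> would need a constant of successor level on top,
      but the only one available at first has level \<open>n = 0\<close>.\<close>
    have "m = 0"
      using I[rule_format, of 0] r0 q0 \<open>n = 0\<close> by (cases "m = 0") auto
    then show "\<forall>p. ?e p \<triangleright> App (Var x) (Stk p)"
      using run'[of 0 "\<lambda>_. p" for p] by simp
  next
    assume "n \<noteq> 0"
    \<comment> \<open>With \<open>m = 0\<close> the run would end on the initial constant, forcing
      its level \<open>n\<close> to be 0.\<close>
    have "m \<noteq> 0"
      using I0 r0 q0 \<open>n \<noteq> 0\<close> by (cases "m = 0") auto
    \<comment> \<open>The witnesses \<open>m\<close>, \<open>r\<close> and \<open>I\<close> come
      from the single run at \<open>c\<close>, hence precede the choice of \<open>p\<close>; only
      the terms \<open>t\<close> are renamed along with \<open>p\<close>.\<close>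
    show "\<exists>(m::nat) (r :: nat \<Rightarrow> nat) (I :: nat \<Rightarrow> nat).
        m \<ge> 1 \<and> (\<forall>i\<le>m. r i \<le> m) \<and>
        I 0 = n \<and> I (r m) = 0 \<and> (\<forall>i<m. int (I (i + 1)) = int (I (r i)) - 1) \<and>
        (\<forall>p :: nat \<Rightarrow> 'p. inj_on p {0..m} \<longrightarrow>
           (\<exists>t :: nat \<Rightarrow> 'p trm.
              (\<forall>i\<in>{1..m}. t i \<in> LCP) \<and>
              ?e (p 0) \<triangleright> App (App (Var g) (t 1)) (Stk (p (r 0))) \<and>
              (\<forall>i. 1 \<le> i \<and> i < m \<longrightarrow>
                 App (t i) (Stk (p i)) \<triangleright> App (App (Var g) (t (i + 1))) (Stk (p (r i)))) \<and>
              App (t m) (Stk (p m)) \<triangleright> App (Var x) (Stk (p (r m)))))"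
    proof (rule exI[of _ m], rule exI[of _ r], rule exI[of _ "\<lambda>i. fst (q i)"],
        intro conjI allI impI)
      fix p :: "nat \<Rightarrow> 'p"
      let ?t = "\<lambda>i. map_trm (f p) (t i)"
      show "\<exists>t :: nat \<Rightarrow> 'p trm.
          (\<forall>i\<in>{1..m}. t i \<in> LCP) \<and>
          ?e (p 0) \<triangleright> App (App (Var g) (t 1)) (Stk (p (r 0))) \<and>
          (\<forall>i. 1 \<le> i \<and> i < m \<longrightarrow>
             App (t i) (Stk (p i)) \<triangleright> App (App (Var g) (t (i + 1))) (Stk (p (r i)))) \<and>
          App (t m) (Stk (p m)) \<triangleright> App (Var x) (Stk (p (r m)))"
      proof (rule exI[of _ ?t], intro conjI allI impI ballI)
        show "?t i \<in> LCP" if "i \<in> {1..m}" for i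
          using that t by (auto intro: map_trm_LCP)
        show "?e (p 0) \<triangleright> App (App (Var g) (?t 1)) (Stk (p (r 0)))"
          using run'[of 0 p] \<open>m \<noteq> 0\<close> by simp
        show "App (?t i) (Stk (p i)) \<triangleright> App (App (Var g) (?t (i + 1))) (Stk (p (r i)))"
          if "1 \<le> i \<and> i < m" for i
          using run'[of i p] that by simp
        show "App (?t m) (Stk (p m)) \<triangleright> App (Var x) (Stk (p (r m)))"
          using run'[of m p] \<open>m \<noteq> 0\<close> by simp
      qed
    qed (use \<open>m \<noteq> 0\<close> r q0 I I0 in auto)
  qed
qed

end
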